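(* Let $m,n\in\mathbb{N}$, $a_1,\dots,a_m\in\mathbb{N}$ and let $b_1,\dots,b_m$ be positive real numbers. Then $$\sum S_{a_m,\dots,a_1}(\pm b_m,\dots,\pm b_1;2n)=\frac{1}{2^{\,\sum_{i=1}^m a_i-m}}\;S_{a_m,\dots,a_1}(b_m^2,\dots,b_1^2;n),$$ where the sum on the left-hand side runs over all $2^m$ choices of the signs $\pm$.
   Context: S-sums: for $a_i\in\mathbb{N}=\{1,2,\dots\}$ and $x_i\in\mathbb{R}\setminus\{0\}$, $$S_{a_1,\dots,a_k}(x_1,\dots,x_k;n)=\sum_{n\ge i_1\ge i_2\ge\cdots\ge i_k\ge1}\frac{x_1^{i_1}}{i_1^{a_1}}\cdots\frac{x_k^{i_k}}{i_k^{a_k}} .$$ *)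

theory Defs
  imports Complex_Main "HOL-Library.FuncSet"
begin

text \<open>
  The S-sum of depth \<open>k\<close> with indices \<open>a 1, \<dots>, a k\<close> and arguments \<open>x 1, \<dots>, x k\<close>.
  The summation tuples \<open>n \<ge> i 1 \<ge> \<dots> \<ge> i k \<ge> 1\<close> are extensional functions on \<open>{1..k}\<close>, so that
  each tuple is counted exactly once.
\<close>

definition S_sum :: "nat \<Rightarrow> (nat \<Rightarrow> nat) \<Rightarrow> (nat \<Rightarrow> real) \<Rightarrow> nat \<Rightarrow> real" where
  "S_sum k a x n =
    (\<Sum>i\<in>{i \<in> {1..k} \<rightarrow>\<^sub>E {1..n}. \<forall>j\<in>{1..<k}. i (j + 1) \<le> i j}.
      \<Prod>j=1..k. x j ^ i j / real (i j) ^ a j)"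

end

theory Submission
  imports Defs
begin

text \<open>
  After exchanging the two sums, the sum over the signs factorises over the coordinates. In each
  coordinate the odd powers cancel and the even ones double, so only the summation tuples with
  all entries even survive. These are the doubles of the tuples bounded by \<open>n\<close>, and each coordinate
  contributes a factor \<open>2 / 2 ^ a\<close>.
\<close>

abbreviation decr_tuples :: "nat \<Rightarrow> nat \<Rightarrow> (nat \<Rightarrow> nat) set" where
  "decr_tuples k n \<equiv> {i \<in> {1..k} \<rightarrow>\<^sub>E {1..n}. \<forall>j\<in>{1..<k}. i (j + 1) \<le> i j}"

lemma finite_decr_tuples: "finite (decr_tuples k n)"
  by (rule finite_subset[OF _ finite_PiE[of "{1..k}" "\<lambda>_. {1..n}"]]) auto

lemma sum_signs_power:
  fixes x :: real
  shows "(\<Sum>s\<in>{1, - 1}. (s * x) ^ i) = (if even i then 2 * x ^ i else 0)"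
  by (auto simp: power_mult_distrib)

text \<open>Indices and arguments are arbitrary sequences \<open>d\<close> and \<open>c\<close>,
  already in summation order; only the signs keep the reversed numbering, so that the theorem
  becomes an instance. For each fixed tuple, the sign sum is a product of two-term sums.\<close>

lemma sum_signs_S_sum:
  fixes c :: "nat \<Rightarrow> real"
  shows "(\<Sum>\<epsilon>\<in>{1..m} \<rightarrow>\<^sub>E {1, - 1 :: real}. S_sum m d (\<lambda>j. \<epsilon> (m + 1 - j) * c j) N) =
    (\<Sum>i\<in>decr_tuples m N. \<Prod>j=1..m. (if even (i j) then 2 * c j ^ i j else 0) / real (i j) ^ d j)"
proof -
  have "(\<Sum>\<epsilon>\<in>{1..m} \<rightarrow>\<^sub>E {1, - 1 :: real}.
      \<Prod>j=1..m. (\<epsilon> (m + 1 - j) * c j) ^ i j / real (i j) ^ d j) =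
    (\<Prod>j=1..m. (if even (i j) then 2 * c j ^ i j else 0) / real (i j) ^ d j)" for i :: "nat \<Rightarrow> nat"
  proof -
    have "(\<Sum>\<epsilon>\<in>{1..m} \<rightarrow>\<^sub>E {1, - 1 :: real}.
        \<Prod>j=1..m. (\<epsilon> (m + 1 - j) * c j) ^ i j / real (i j) ^ d j) =
      (\<Sum>\<epsilon>\<in>{1..m} \<rightarrow>\<^sub>E {1, - 1 :: real}.
        \<Prod>j=1..m. (\<epsilon> j * c (m + 1 - j)) ^ i (m + 1 - j) / real (i (m + 1 - j)) ^ d (m + 1 - j))"
      by (intro sum.cong refl, subst prod.atLeastAtMost_rev) (auto intro!: prod.cong)
    also have "\<dots> = (\<Prod>j=1..m. \<Sum>s\<in>{1, - 1 :: real}.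
        (s * c (m + 1 - j)) ^ i (m + 1 - j) / real (i (m + 1 - j)) ^ d (m + 1 - j))"
      by (rule prod_sum_PiE[symmetric]) auto
    also have "\<dots> = (\<Prod>j=1..m. \<Sum>s\<in>{1, - 1 :: real}. (s * c j) ^ i j / real (i j) ^ d j)"
      by (subst (2) prod.atLeastAtMost_rev) (auto intro!: prod.cong)
    also have "\<dots> = (\<Prod>j=1..m. (if even (i j) then 2 * c j ^ i j else 0) / real (i j) ^ d j)"
      by (simp only: sum_divide_distrib[symmetric] sum_signs_power)
    finally show ?thesis .
  qed
  then show ?thesis
    unfolding S_sum_def by (subst sum.swap) simp
qed

text \<open>Halving inverts doubling on even entries and, being monotone, preserves the chain of
  inequalities. Restricting to \<open>{1..m}\<close> keeps both maps within extensional
  functions.\<close>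

lemma double_decr_tuples:
  "(\<lambda>i. \<lambda>j\<in>{1..m}. 2 * i j) ` decr_tuples m n = {i \<in> decr_tuples m (2 * n). \<forall>j\<in>{1..m}. even (i j)}"
  (is "?f ` _ = ?E")
proof (intro equalityI subsetI)
  fix i assume "i \<in> ?f ` decr_tuples m n"
  then show "i \<in> ?E" by (fastforce simp: PiE_iff)
next
  fix i assume i: "i \<in> ?E"
  define h where "h = (\<lambda>j\<in>{1..m}. i j div 2)"
  \<comment> \<open>The lower bound uses parity: a positive even entry is at least 2.\<close>
  have "1 \<le> i j div 2 \<and> i j div 2 \<le> n" if "j \<in> {1..m}" for j
  proof -
    have "1 \<le> i j" "i j \<le> 2 * n" "even (i j)"
      using i that by (auto simp: PiE_iff)
    then show ?thesis by presburger
  qed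
  then have "h \<in> decr_tuples m n"
    using i by (auto simp: h_def PiE_iff intro!: div_le_mono)
  moreover have "?f h = i"
    using i by (auto simp: h_def PiE_iff fun_eq_iff extensional_def)
  ultimately show "i \<in> ?f ` decr_tuples m n" by blast
qed

lemma inj_on_double:
  "inj_on (\<lambda>i. \<lambda>j\<in>A. 2 * i j :: nat) (A \<rightarrow>\<^sub>E B)"
proof (rule inj_onI)
  fix f g assume *: "f \<in> A \<rightarrow>\<^sub>E B" "g \<in> A \<rightarrow>\<^sub>E B" "(\<lambda>j\<in>A. 2 * f j) = (\<lambda>j\<in>A. 2 * g j)"
  show "f = g"
  proof (rule PiE_ext[OF *(1,2)])
    fix j assume "j \<in> A"
    then show "f j = g j" using fun_cong[OF *(3), of j] by simp
  qed
qed

text \<open>Collects the constants of the single coordinates. As every \<open>a i\<close> is at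
  least 1, no subtraction of naturals is truncated, and the exponents add up.\<close>

lemma prod_half_powers:
  assumes "\<And>i. i \<in> A \<Longrightarrow> a i \<ge> (1::nat)"
  shows "(\<Prod>i\<in>A. 1 / 2 ^ (a i - 1)) = 1 / (2 :: real) ^ ((\<Sum>i\<in>A. a i) - card A)"
proof -
  have "(\<Sum>i\<in>A. a i - 1) = (\<Sum>i\<in>A. a i) - card A"
    using assms by (subst sum_subtractf_nat) auto
  then show ?thesis
    by (simp add: prod_dividef power_sum[symmetric])
qed

lemma sum_signs_S_sum_double:
  fixes c :: "nat \<Rightarrow> real"
  assumes d: "\<And>j. j \<in> {1..m} \<Longrightarrow> d j \<ge> 1"
  shows "(\<Sum>\<epsilon>\<in>{1..m} \<rightarrow>\<^sub>E {1, - 1 :: real}. S_sum m d (\<lambda>j. \<epsilon> (m + 1 - j) * c j) (2 * n)) =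
    1 / 2 ^ ((\<Sum>j=1..m. d j) - m) * S_sum m d (\<lambda>j. (c j)\<^sup>2) n"
proof -
  let ?t = "\<lambda>i. \<Prod>j=1..m. (if even (i j) then 2 * c j ^ i j else 0) / real (i j) ^ d j"
  let ?f = "\<lambda>i. \<lambda>j\<in>{1..m}. 2 * i j :: nat"
  have inj: "inj_on ?f (decr_tuples m n)"
    by (rule inj_on_subset[OF inj_on_double]) auto
  \<comment> \<open>The 2 from the two signs cancels one of the \<open>e\<close> factors 2 in the
    denominator.\<close>
  have factor: "2 * x ^ (2 * k) / real (2 * k) ^ e = 1 / 2 ^ (e - 1) * ((x\<^sup>2) ^ k / real k ^ e)"
    if "e \<ge> 1" for x :: real and k e
    using that by (cases e) (simp_all add: power_mult power_mult_distrib)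
  have "(\<Sum>\<epsilon>\<in>{1..m} \<rightarrow>\<^sub>E {1, - 1 :: real}. S_sum m d (\<lambda>j. \<epsilon> (m + 1 - j) * c j) (2 * n)) =
      (\<Sum>i\<in>decr_tuples m (2 * n). ?t i)"
    by (rule sum_signs_S_sum)
  also have "\<dots> = (\<Sum>i\<in>?f ` decr_tuples m n. ?t i)"
    unfolding double_decr_tuples
  \<comment> \<open>A single odd entry already puts a zero factor into the product.\<close>
  proof (rule sum.mono_neutral_right[OF finite_decr_tuples], blast, intro ballI)
    fix i assume "i \<in> decr_tuples m (2 * n) - {i \<in> decr_tuples m (2 * n). \<forall>j\<in>{1..m}. even (i j)}"
    then obtain j where "j \<in> {1..m}" "odd (i j)" by blast
    then show "?t i = 0" by (intro prod_zero) (auto intro!: bexI[of _ j])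
  qed
  also have "\<dots> = (\<Sum>i\<in>decr_tuples m n. ?t (?f i))"
    by (subst sum.reindex[OF inj]) (simp only: comp_def)
  also have "\<dots> = (\<Sum>i\<in>decr_tuples m n.
      (\<Prod>j=1..m. 1 / 2 ^ (d j - 1)) * (\<Prod>j=1..m. ((c j)\<^sup>2) ^ i j / real (i j) ^ d j))"
    unfolding prod.distrib[symmetric] using d factor by (intro sum.cong prod.cong refl) simp
  finally show ?thesis
    using prod_half_powers[of "{1..m}" d] d by (simp add: S_sum_def sum_distrib_left)
qed

theorem theorem3p6p3:
  fixes m n :: nat and a :: "nat \<Rightarrow> nat" and b :: "nat \<Rightarrow> real"
  assumes "m \<ge> 1" and "n \<ge> 1"
    and "\<And>i. i \<in> {1..m} \<Longrightarrow> a i \<ge> 1"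
    and "\<And>i. i \<in> {1..m} \<Longrightarrow> b i > 0"
  shows "(\<Sum>\<epsilon>\<in>{1..m} \<rightarrow>\<^sub>E {1, - 1 :: real}.
            S_sum m (\<lambda>j. a (m + 1 - j)) (\<lambda>j. \<epsilon> (m + 1 - j) * b (m + 1 - j)) (2 * n)) =
         1 / 2 ^ ((\<Sum>i=1..m. a i) - m) *
            S_sum m (\<lambda>j. a (m + 1 - j)) (\<lambda>j. (b (m + 1 - j))\<^sup>2) n"
proof -
  have "(\<Sum>j=1..m. a (m + 1 - j)) = (\<Sum>i=1..m. a i)"
    by (subst (2) sum.atLeastAtMost_rev) simp
  moreover have "a (m + 1 - j) \<ge> 1" if "j \<in> {1..m}" for j
    using that by (intro assms(3)) auto
  ultimately show ?thesis
    \<comment> \<open>Both sequences enter reversed; the exponent of 2 is unaffected, since it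
      involves only the total of the indices.\<close>
    using sum_signs_S_sum_double[of m "\<lambda>j. a (m + 1 - j)" "\<lambda>j. b (m + 1 - j)" n] by simp
qed

end
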